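(* Let $a,b,c,t_0\in\mathbb{R}$ and $h\in L^1_{\mathrm{loc}}(\mathbb{R})$. The problem $$u'(t)+a\,u(-t)+b\,u(t)=h(t)\ \text{ for a.e. } t\in\mathbb{R},\qquad u(t_0)=c,$$ has a unique solution $u\in W^{1,1}_{\mathrm{loc}}(\mathbb{R})$ if and only if $\tilde u(t_0)\neq0$, where $\tilde u$ is the solution of $$\tilde u'(t)+a\,\tilde u(-t)+b\,\tilde u(t)=0\ (t\in\mathbb{R}),\qquad \tilde u(0)=1.$$
   Context: With $\omega:=\sqrt{|a^2-b^2|}$, the function $\tilde u$ is given explicitly by: $\tilde u(t)=\cos\omega t-\frac{a+b}{\omega}\sin\omega t$ if $a^2>b^2$; $\tilde u(t)=\cosh\omega t-\frac{a+b}{\omega}\sinh\omega t$ if $a^2<b^2$; $\tilde u(t)=1-2at$ if $a=b$; $\tilde u(t)=1$ if $a=-b$. $W^{1,1}_{\mathrm{loc}}(\mathbb{R})$ is the space of locally absolutely continuous functions on $\mathbb{R}$. *)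

theory Defs
  imports "HOL-Analysis.Analysis"
begin

text \<open>The usual epsilon-delta notion of absolute continuity; the finite families of
  non-overlapping compact subintervals of \<open>S\<close> are the divisions of subsets of \<open>S\<close>.\<close>

definition abs_continuous_on :: "real set \<Rightarrow> (real \<Rightarrow> real) \<Rightarrow> bool" where
  "abs_continuous_on S f \<longleftrightarrow>
     (\<forall>\<epsilon>>0. \<exists>\<delta>>0. \<forall>D T. D division_of T \<and> T \<subseteq> S \<and> (\<Sum>K\<in>D. Sup K - Inf K) < \<delta> \<longrightarrow>
        (\<Sum>K\<in>D. \<bar>f (Sup K) - f (Inf K)\<bar>) < \<epsilon>)"

text \<open>Every Sobolev class is represented by its unique continuous representative, so
  \<open>W\<^sup>1\<^sup>,\<^sup>1\<^sub>l\<^sub>o\<^sub>c\<close> is a set of functions and uniqueness below means equality everywhere.\<close>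

definition W11_loc :: "(real \<Rightarrow> real) set" where
  "W11_loc = {u. \<forall>x y. abs_continuous_on {x..y} u}"

definition L1_loc :: "(real \<Rightarrow> real) set" where
  "L1_loc = {h. \<forall>K. compact K \<longrightarrow> set_integrable lebesgue K h}"

definition satisfies_ode_at ::
  "real \<Rightarrow> real \<Rightarrow> (real \<Rightarrow> real) \<Rightarrow> (real \<Rightarrow> real) \<Rightarrow> real \<Rightarrow> bool" where
  "satisfies_ode_at a b h u t \<longleftrightarrow>
     u differentiable (at t) \<and> deriv u t + a * u (- t) + b * u t = h t"

definition solves_homogeneous :: "real \<Rightarrow> real \<Rightarrow> (real \<Rightarrow> real) \<Rightarrow> bool" where
  "solves_homogeneous a b w \<longleftrightarrow> (\<forall>t. satisfies_ode_at a b (\<lambda>_. 0) w t) \<and> w 0 = 1"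

text \<open>The description is meaningful: see \<open>solves_homogeneous_unique\<close> and
  \<open>u_tilde_closed_form\<close> below.\<close>

definition u_tilde :: "real \<Rightarrow> real \<Rightarrow> real \<Rightarrow> real" where
  "u_tilde a b = (THE w. solves_homogeneous a b w)"

lemma solves_homogeneous_iff_DERIV:
  "solves_homogeneous a b w \<longleftrightarrow>
     (\<forall>t. (w has_real_derivative (- a * w (- t) - b * w t)) (at t)) \<and> w 0 = 1"
proof -
  have "satisfies_ode_at a b (\<lambda>_. 0) w t \<longleftrightarrow>
      (w has_real_derivative (- a * w (- t) - b * w t)) (at t)" for t
  proof
    assume A: "satisfies_ode_at a b (\<lambda>_. 0) w t"
    then have "(w has_real_derivative deriv w t) (at t)"
      unfolding satisfies_ode_at_def
      by (metis DERIV_imp_deriv real_differentiable_def)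
    moreover have "deriv w t = - a * w (- t) - b * w t"
      using A unfolding satisfies_ode_at_def by simp
    ultimately show "(w has_real_derivative (- a * w (- t) - b * w t)) (at t)" by simp
  next
    assume A: "(w has_real_derivative (- a * w (- t) - b * w t)) (at t)"
    then show "satisfies_ode_at a b (\<lambda>_. 0) w t"
      unfolding satisfies_ode_at_def
      using DERIV_imp_deriv[OF A] real_differentiable_def by auto
  qed
  then show ?thesis unfolding solves_homogeneous_def by blast
qed

lemma solves_homogeneous_unique:
  assumes "solves_homogeneous a b w1" "solves_homogeneous a b w2"
  shows "w1 = w2"
proof -
  define d where "d t = w1 t - w2 t" for t
  have d0: "d 0 = 0"
    using assms unfolding d_def solves_homogeneous_def by simp
  have d': "(d has_real_derivative (- a * d (- t) - b * d t)) (at t)" for t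
  proof -
    have "((\<lambda>t. w1 t - w2 t) has_real_derivative
        (- a * w1 (- t) - b * w1 t) - (- a * w2 (- t) - b * w2 t)) (at t)"
      using assms unfolding solves_homogeneous_iff_DERIV by (intro DERIV_diff) auto
    then show ?thesis unfolding d_def by (simp add: algebra_simps)
  qed
  have m': "((\<lambda>t. d (- t)) has_real_derivative (a * d t + b * d (- t))) (at t)" for t
  proof -
    have "((\<lambda>t. d (- t)) has_real_derivative (- a * d (- (- t)) - b * d (- t)) * - 1) (at t)"
      by (rule DERIV_chain2[where f = d and g = uminus, OF d'[of "- t"] DERIV_minus[OF DERIV_ident]])
    then show ?thesis by (simp add: algebra_simps)
  qed
  define E where "E t = exp (- (2 * \<bar>b\<bar>) * t) * ((d t)\<^sup>2 + (d (- t))\<^sup>2)" for t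
  define E' where "E' t = exp (- (2 * \<bar>b\<bar>) * t) *
      (2 * b * ((d (- t))\<^sup>2 - (d t)\<^sup>2) - 2 * \<bar>b\<bar> * ((d t)\<^sup>2 + (d (- t))\<^sup>2))" for t
  have E': "(E has_real_derivative E' t) (at t)" for t
    unfolding E_def[abs_def] E'_def
    by (rule derivative_eq_intros d' m' refl | simp)+
       (simp add: algebra_simps power2_eq_square)
  have "E' t \<le> 0" for t
  proof -
    have "b * ((d (- t))\<^sup>2 - (d t)\<^sup>2) \<le> \<bar>b\<bar> * ((d t)\<^sup>2 + (d (- t))\<^sup>2)"
    proof -
      have "b * ((d (- t))\<^sup>2 - (d t)\<^sup>2) \<le> \<bar>b\<bar> * \<bar>(d (- t))\<^sup>2 - (d t)\<^sup>2\<bar>"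
        by (metis abs_ge_self abs_mult)
      also have "\<dots> \<le> \<bar>b\<bar> * ((d t)\<^sup>2 + (d (- t))\<^sup>2)"
        by (intro mult_left_mono) (auto simp: abs_if)
      finally show ?thesis .
    qed
    then show ?thesis unfolding E'_def by (intro mult_nonneg_nonpos) auto
  qed
  then have "E t \<le> E 0" if "t \<ge> 0" for t
    using DERIV_nonpos_imp_nonincreasing[OF that, of E] E' by blast
  then have "(d t)\<^sup>2 + (d (- t))\<^sup>2 \<le> 0" if "t \<ge> 0" for t
    using that by (force simp: E_def d0 mult_le_0_iff)
  then have z: "d t = 0 \<and> d (- t) = 0" if "t \<ge> 0" for t
    using that by (meson sum_power2_le_zero_iff)
  have "d t = 0" for t
    using z[of t] z[of "- t"] by (cases "t \<ge> 0") auto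
  then show ?thesis unfolding d_def by (intro ext) simp
qed

lemma u_tilde_eqI: "solves_homogeneous a b w \<Longrightarrow> u_tilde a b = w"
  unfolding u_tilde_def by (intro the_equality) (auto intro: solves_homogeneous_unique)

lemma u_tilde_closed_form:
  fixes a b :: real
  defines "\<omega> \<equiv> sqrt \<bar>a\<^sup>2 - b\<^sup>2\<bar>"
  shows "a\<^sup>2 > b\<^sup>2 \<Longrightarrow> u_tilde a b = (\<lambda>t. cos (\<omega> * t) - (a + b) / \<omega> * sin (\<omega> * t))"
    and "a\<^sup>2 < b\<^sup>2 \<Longrightarrow> u_tilde a b = (\<lambda>t. cosh (\<omega> * t) - (a + b) / \<omega> * sinh (\<omega> * t))"
    and "a = b \<Longrightarrow> u_tilde a b = (\<lambda>t. 1 - 2 * a * t)"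
    and "a = - b \<Longrightarrow> u_tilde a b = (\<lambda>t. 1)"
proof -
  assume A: "a\<^sup>2 > b\<^sup>2"
  then have w: "\<omega> * \<omega> = a * a - b * b" "\<omega> \<noteq> 0"
    unfolding \<omega>_def by (auto simp: power2_eq_square)
  have "((\<lambda>t. cos (\<omega> * t) - (a + b) / \<omega> * sin (\<omega> * t)) has_real_derivative
      - \<omega> * sin (\<omega> * t) - (a + b) * cos (\<omega> * t)) (at t)" for t
    using w(2) by (auto intro!: derivative_eq_intros)
  moreover have "\<omega> * s = (a * a - b * b) / \<omega> * s" for s
    using w by (metis nonzero_mult_div_cancel_left)
  ultimately show "u_tilde a b = (\<lambda>t. cos (\<omega> * t) - (a + b) / \<omega> * sin (\<omega> * t))"
    by (intro u_tilde_eqI)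
       (simp add: solves_homogeneous_iff_DERIV algebra_simps add_divide_distrib diff_divide_distrib)
next
  assume A: "a\<^sup>2 < b\<^sup>2"
  then have w: "\<omega> * \<omega> = b * b - a * a" "\<omega> \<noteq> 0"
    unfolding \<omega>_def by (auto simp: power2_eq_square)
  have "((\<lambda>t. cosh (\<omega> * t) - (a + b) / \<omega> * sinh (\<omega> * t)) has_real_derivative
      \<omega> * sinh (\<omega> * t) - (a + b) * cosh (\<omega> * t)) (at t)" for t
    using w(2) by (auto intro!: derivative_eq_intros)
  moreover have "\<omega> * s = (b * b - a * a) / \<omega> * s" for s
    using w by (metis nonzero_mult_div_cancel_left)
  ultimately show "u_tilde a b = (\<lambda>t. cosh (\<omega> * t) - (a + b) / \<omega> * sinh (\<omega> * t))"
    by (intro u_tilde_eqI)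
       (simp add: solves_homogeneous_iff_DERIV algebra_simps add_divide_distrib diff_divide_distrib)
next
  assume "a = b"
  then show "u_tilde a b = (\<lambda>t. 1 - 2 * a * t)"
    by (intro u_tilde_eqI)
       (auto simp: solves_homogeneous_iff_DERIV algebra_simps intro!: derivative_eq_intros)
next
  assume "a = - b"
  then show "u_tilde a b = (\<lambda>t. 1)"
    by (intro u_tilde_eqI) (auto simp: solves_homogeneous_iff_DERIV)
qed

end

theory Submission
  imports Defs
begin

text \<open>The locally absolutely continuous solutions of the equation form an affine line
  \<open>{p + r w | r}\<close> with \<open>w = u_tilde a b\<close>. Imposing \<open>u t0 = c\<close> means solving
  \<open>p t0 + r w t0 = c\<close> for \<open>r\<close>, which has exactly one solution if \<open>w t0 \<noteq> 0\<close> and none or every \<open>r\<close>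
  if \<open>w t0 = 0\<close>; distinct \<open>r\<close> give distinct solutions because \<open>w 0 = 1\<close>.

  That the solutions form such a line rests on two facts. The homogeneous solutions
  are the multiples of \<open>w\<close> (\<open>homogeneous_solution_eq_multiple_u_tilde\<close>): an absolutely continuous
  function with zero derivative almost everywhere is constant, so a solution almost
  everywhere is a classical one. And a particular solution exists for every
  locally integrable \<open>h\<close> (\<open>particular_solution_exists\<close>): variation of constants for the linear system
  satisfied by \<open>u t\<close> and \<open>u (- t)\<close> yields an explicit formula in terms of a primitive of a locally
  integrable function. The formula solves the equation because such primitives
  are locally absolutely continuous (\<open>is_primitive_W11_loc\<close>) and almost everywhere
  differentiable with the expected derivative (\<open>is_primitive_AE_deriv\<close>).\<close>

section \<open>Calculus of absolutely continuous functions\<close>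

lemma division_of_real_memE:
  fixes D :: "real set set"
  assumes "D division_of T" "K \<in> D"
  obtains u v where "u \<le> v" "K = {u..v}" "Inf K = u" "Sup K = v" "u \<in> T" "v \<in> T"
proof -
  obtain u v where K: "K = {u..v}"
    using division_ofD(4)[OF assms] by auto
  moreover have "u \<le> v"
    using division_ofD(3)[OF assms] K by auto
  moreover have "u \<in> T" "v \<in> T"
    using division_ofD(2)[OF assms] K \<open>u \<le> v\<close> by auto
  ultimately show thesis
    using that by simp
qed

text \<open>Absolute continuity only sees increments over intervals, so control of the increments of
  \<open>F\<close> by those of \<open>f\<close> and \<open>g\<close> is all that is needed. Sums and products of absolutely
  continuous functions are instances.\<close>
lemma abs_continuous_on_increment_le:
  assumes f: "abs_continuous_on S f" and g: "abs_continuous_on S g"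
    and le: "\<And>x y. x \<in> S \<Longrightarrow> y \<in> S \<Longrightarrow> \<bar>F y - F x\<bar> \<le> B * (\<bar>f y - f x\<bar> + \<bar>g y - g x\<bar>)"
  shows "abs_continuous_on S F"
  unfolding abs_continuous_on_def
proof (intro allI impI)
  fix e :: real
  assume "e > 0"
  define B' where "B' = \<bar>B\<bar> + 1"
  have "B' > 0" "B \<le> B'"
    by (auto simp: B'_def)
  have e: "e / (2 * B') > 0"
    using \<open>e > 0\<close> \<open>B' > 0\<close> by simp
  obtain d1 where d1: "d1 > 0" and
    f': "\<And>D T. D division_of T \<Longrightarrow> T \<subseteq> S \<Longrightarrow> (\<Sum>K\<in>D. Sup K - Inf K) < d1 \<Longrightarrow>
      (\<Sum>K\<in>D. \<bar>f (Sup K) - f (Inf K)\<bar>) < e / (2 * B')"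
    using f e unfolding abs_continuous_on_def by meson
  obtain d2 where d2: "d2 > 0" and
    g': "\<And>D T. D division_of T \<Longrightarrow> T \<subseteq> S \<Longrightarrow> (\<Sum>K\<in>D. Sup K - Inf K) < d2 \<Longrightarrow>
      (\<Sum>K\<in>D. \<bar>g (Sup K) - g (Inf K)\<bar>) < e / (2 * B')"
    using g e unfolding abs_continuous_on_def by meson
  have "(\<Sum>K\<in>D. \<bar>F (Sup K) - F (Inf K)\<bar>) < e"
    if D: "D division_of T" "T \<subseteq> S" "(\<Sum>K\<in>D. Sup K - Inf K) < min d1 d2" for D T
  proof -
    have "\<bar>F (Sup K) - F (Inf K)\<bar>
        \<le> B' * (\<bar>f (Sup K) - f (Inf K)\<bar> + \<bar>g (Sup K) - g (Inf K)\<bar>)" if "K \<in> D" for K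
    proof -
      have "\<bar>F (Sup K) - F (Inf K)\<bar>
          \<le> B * (\<bar>f (Sup K) - f (Inf K)\<bar> + \<bar>g (Sup K) - g (Inf K)\<bar>)"
        using division_of_real_memE[OF D(1) that] le D(2) by (metis subsetD)
      also have "\<dots> \<le> B' * (\<bar>f (Sup K) - f (Inf K)\<bar> + \<bar>g (Sup K) - g (Inf K)\<bar>)"
        using \<open>B \<le> B'\<close> by (intro mult_right_mono) auto
      finally show ?thesis .
    qed
    then have "(\<Sum>K\<in>D. \<bar>F (Sup K) - F (Inf K)\<bar>)
        \<le> (\<Sum>K\<in>D. B' * (\<bar>f (Sup K) - f (Inf K)\<bar> + \<bar>g (Sup K) - g (Inf K)\<bar>))"
      by (rule sum_mono)
    also have "\<dots> = B' * ((\<Sum>K\<in>D. \<bar>f (Sup K) - f (Inf K)\<bar>) + (\<Sum>K\<in>D. \<bar>g (Sup K) - g (Inf K)\<bar>))"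
      unfolding sum.distrib[symmetric] sum_distrib_left ..
    also have "\<dots> < B' * (e / (2 * B') + e / (2 * B'))"
      using f'[OF D(1,2)] g'[OF D(1,2)] D(3) \<open>B' > 0\<close>
      by (intro mult_strict_left_mono add_strict_mono) auto
    also have "\<dots> = e"
      using \<open>B' > 0\<close> by simp
    finally show ?thesis .
  qed
  then show "\<exists>\<delta>>0. \<forall>D T. D division_of T \<and> T \<subseteq> S \<and> (\<Sum>K\<in>D. Sup K - Inf K) < \<delta> \<longrightarrow>
      (\<Sum>K\<in>D. \<bar>F (Sup K) - F (Inf K)\<bar>) < e"
    using d1 d2 by (intro exI[of _ "min d1 d2"]) auto
qed

lemma abs_continuous_on_imp_continuous_on:
  assumes "abs_continuous_on {x..y} f"
  shows "continuous_on {x..y} f"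
  unfolding continuous_on_iff
proof (intro ballI allI impI)
  fix s and e :: real
  assume s: "s \<in> {x..y}" and "e > 0"
  then obtain d where "d > 0" and d: "\<And>D T. D division_of T \<Longrightarrow> T \<subseteq> {x..y} \<Longrightarrow>
      (\<Sum>K\<in>D. Sup K - Inf K) < d \<Longrightarrow> (\<Sum>K\<in>D. \<bar>f (Sup K) - f (Inf K)\<bar>) < e"
    using assms unfolding abs_continuous_on_def by meson
  have near: "\<bar>f v - f u\<bar> < e" if "u \<le> v" "v - u < d" "u \<in> {x..y}" "v \<in> {x..y}" for u v
    using d[OF division_of_self[of u v]] that by simp
  have "dist (f t) (f s) < e" if "t \<in> {x..y}" "dist t s < d" for t
    using near[of s t] near[of t s] that s
    by (cases "s \<le> t") (auto simp: dist_real_def abs_minus_commute)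
  then show "\<exists>d>0. \<forall>t\<in>{x..y}. dist t s < d \<longrightarrow> dist (f t) (f s) < e"
    using \<open>d > 0\<close> by blast
qed

lemma abs_continuous_on_bounded_image:
  assumes "abs_continuous_on {x..y} f"
  obtains B where "\<And>t. t \<in> {x..y} \<Longrightarrow> \<bar>f t\<bar> \<le> B"
proof -
  have "bounded (f ` {x..y})"
    using abs_continuous_on_imp_continuous_on[OF assms]
    by (simp add: compact_continuous_image compact_imp_bounded)
  then show thesis
    using that unfolding bounded_iff by (metis imageI real_norm_def)
qed

lemma W11_loc_imp_continuous:
  assumes "f \<in> W11_loc"
  shows "continuous_on UNIV f"
proof -
  have "isCont f t" for t
    using abs_continuous_on_imp_continuous_on[of "t - 1" "t + 1" f] assms
    by (auto simp: W11_loc_def intro: continuous_on_interior)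
  then show ?thesis
    by (simp add: continuous_at_imp_continuous_on)
qed

lemma W11_loc_add:
  assumes "f \<in> W11_loc" "g \<in> W11_loc"
  shows "(\<lambda>t. f t + g t) \<in> W11_loc"
  unfolding W11_loc_def
proof (intro CollectI allI)
  fix x y
  show "abs_continuous_on {x..y} (\<lambda>t. f t + g t)"
    by (rule abs_continuous_on_increment_le[of _ f g _ 1])
       (use assms in \<open>auto simp: W11_loc_def\<close>)
qed

lemma W11_loc_mult:
  assumes "f \<in> W11_loc" "g \<in> W11_loc"
  shows "(\<lambda>t. f t * g t) \<in> W11_loc"
  unfolding W11_loc_def
proof (intro CollectI allI)
  fix x y
  have ac: "abs_continuous_on {x..y} f" "abs_continuous_on {x..y} g"
    using assms by (auto simp: W11_loc_def)
  obtain A where A: "\<And>t. t \<in> {x..y} \<Longrightarrow> \<bar>f t\<bar> \<le> A"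
    using abs_continuous_on_bounded_image[OF ac(1)] by blast
  obtain B where B: "\<And>t. t \<in> {x..y} \<Longrightarrow> \<bar>g t\<bar> \<le> B"
    using abs_continuous_on_bounded_image[OF ac(2)] by blast
  show "abs_continuous_on {x..y} (\<lambda>t. f t * g t)"
  proof (rule abs_continuous_on_increment_le[OF ac])
    fix s t assume st: "s \<in> {x..y}" "t \<in> {x..y}"
    have "\<bar>f t * g t - f s * g s\<bar> = \<bar>(f t - f s) * g t + f s * (g t - g s)\<bar>"
      by (simp add: algebra_simps)
    also have "\<dots> \<le> \<bar>f t - f s\<bar> * \<bar>g t\<bar> + \<bar>f s\<bar> * \<bar>g t - g s\<bar>"
      by (metis abs_mult abs_triangle_ineq)
    also have "\<dots> \<le> \<bar>f t - f s\<bar> * max A B + max A B * \<bar>g t - g s\<bar>"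
      using A[OF st(1)] B[OF st(2)] by (intro add_mono mult_left_mono mult_right_mono) auto
    finally show "\<bar>f t * g t - f s * g s\<bar> \<le> max A B * (\<bar>f t - f s\<bar> + \<bar>g t - g s\<bar>)"
      by (simp add: algebra_simps)
  qed
qed

lemma W11_loc_const: "(\<lambda>_. c) \<in> W11_loc"
  by (auto simp: W11_loc_def abs_continuous_on_def intro: exI[of _ 1])

lemma W11_loc_diff:
  assumes "f \<in> W11_loc" "g \<in> W11_loc"
  shows "(\<lambda>t. f t - g t) \<in> W11_loc"
  using W11_loc_add[OF assms(1) W11_loc_mult[OF W11_loc_const[of "-1"] assms(2)]] by simp

text \<open>Given \<open>e > 0\<close>, cover the exceptional null set \<open>N\<close> by an open set \<open>G\<close> so small that the
  increments of \<open>f\<close> over non-overlapping intervals inside \<open>G\<close> sum to less than \<open>e\<close>. Every point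
  outside \<open>N\<close> has a neighbourhood in which \<open>f\<close> has slope at most \<open>e\<close> as seen from that point. The
  two kinds of neighbourhoods form a gauge, and a tagged division that is fine for it
  bounds \<open>\<bar>f b - f a\<bar>\<close> by \<open>e + e * (b - a)\<close>.\<close>
lemma abs_continuous_on_AE_deriv_0_imp_eq:
  assumes "a \<le> b" and ac: "abs_continuous_on {a..b} f" and N: "negligible N"
    and deriv: "\<And>x. x \<notin> N \<Longrightarrow> (f has_real_derivative 0) (at x)"
  shows "f a = f b"
proof -
  have bound: "\<bar>f b - f a\<bar> \<le> e * (1 + (b - a))" if "e > 0" for e
  proof -
    obtain d where "d > 0" and d: "\<And>D T. D division_of T \<Longrightarrow> T \<subseteq> {a..b} \<Longrightarrow>
        (\<Sum>K\<in>D. Sup K - Inf K) < d \<Longrightarrow> (\<Sum>K\<in>D. \<bar>f (Sup K) - f (Inf K)\<bar>) < e"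
      using ac \<open>e > 0\<close> unfolding abs_continuous_on_def by meson
    obtain G where G: "open G" "N \<subseteq> G" "G - N \<in> lmeasurable" "emeasure lebesgue (G - N) < ennreal d"
      using sets_lebesgue_outer_open[OF _ \<open>d > 0\<close>] negligible_imp_sets[OF N] by metis
    have G_lm: "G \<in> lmeasurable" "measure lebesgue G < d"
    proof -
      have "(G - N) \<union> N = G"
        using G(2) by blast
      then show "G \<in> lmeasurable"
        by (metis G(3) N fmeasurable.Un negligible_imp_measurable)
      have "measure lebesgue G = measure lebesgue (G - N)"
        using N by (metis measure_Diff_null_set \<open>G \<in> lmeasurable\<close> fmeasurableD negligible_iff_null_sets)
      also have "\<dots> < d"
        using G(4) \<open>d > 0\<close> by (simp add: emeasure_eq_measure2[OF G(3)] ennreal_less_iff)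
      finally show "measure lebesgue G < d" .
    qed
    have "\<exists>r>0. \<forall>y. \<bar>y - x\<bar> < r \<longrightarrow> \<bar>f y - f x\<bar> \<le> e * \<bar>y - x\<bar>" if "x \<notin> N" for x
      using deriv[OF that] \<open>e > 0\<close>
      unfolding has_field_derivative_def has_derivative_at_alt by simp
    then obtain r where r: "\<And>x. x \<notin> N \<Longrightarrow> r x > 0"
      "\<And>x y. x \<notin> N \<Longrightarrow> \<bar>y - x\<bar> < r x \<Longrightarrow> \<bar>f y - f x\<bar> \<le> e * \<bar>y - x\<bar>"
      by metis
    define g where "g x = (if x \<in> N then G else ball x (r x))" for x
    have "gauge g"
      using G(1,2) r(1) by (auto simp: gauge_def g_def)
    then obtain p where p: "p tagged_division_of {a..b}" "g fine p"
      using fine_division_exists_real by blast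
    note p' = tagged_division_ofD[OF p(1)]
    let ?q = "{(x, K) \<in> p. x \<in> N}"
    have "?q tagged_partial_division_of {a..b}"
      using p(1) tagged_partial_division_subset[of p _ ?q] by (auto simp: tagged_division_of_def)
    then have q: "?q tagged_division_of \<Union>(snd ` ?q)"
      by (rule tagged_partial_division_of_Union_self)
    then have D: "snd ` ?q division_of \<Union>(snd ` ?q)"
      by (rule division_of_tagged_division)
    have sub: "\<Union>(snd ` ?q) \<subseteq> {a..b}" "\<Union>(snd ` ?q) \<subseteq> G"
      using p'(3) p(2) by (fastforce simp: fine_def g_def)+
    have len: "Sup K - Inf K = measure lebesgue K" if "K \<in> snd ` ?q" for K
      by (rule division_of_real_memE[OF D that]) simp
    have "(\<Sum>K\<in>snd ` ?q. Sup K - Inf K) = measure lebesgue (\<Union>(snd ` ?q))"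
      using content_division[OF D] len by simp
    also have "\<dots> \<le> measure lebesgue G"
      using sub(2) G_lm(1) lmeasurable_division[OF D] by (intro measure_mono_fmeasurable) auto
    finally have "(\<Sum>K\<in>snd ` ?q. \<bar>f (Sup K) - f (Inf K)\<bar>) < e"
      using d[OF D sub(1)] G_lm(2) by linarith
    moreover have "(\<Sum>(x, K)\<in>?q. \<bar>f (Sup K) - f (Inf K)\<bar>) = (\<Sum>K\<in>snd ` ?q. \<bar>f (Sup K) - f (Inf K)\<bar>)"
    proof -
      \<comment> \<open>Guarding the empty set makes the summand vanish on every degenerate box, where \<open>Sup {}\<close> and
        \<open>Inf {}\<close> are unspecified; distinct tags may then share a degenerate interval.\<close>
      define \<phi> where "\<phi> K = (if K = {} then 0 else \<bar>f (Sup K) - f (Inf K)\<bar>)" for K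
      have "\<phi> K = \<bar>f (Sup K) - f (Inf K)\<bar>" if "K \<in> snd ` ?q" for K
        using division_ofD(3)[OF D that] by (simp add: \<phi>_def)
      moreover have "(\<Sum>(x, K)\<in>?q. \<phi> K) = (\<Sum>K\<in>snd ` ?q. \<phi> K)"
        by (rule sum.over_tagged_division_lemma[OF q]) (auto simp: \<phi>_def box_eq_empty)
      ultimately show ?thesis
        by (simp add: case_prod_unfold)
    qed
    ultimately have on_N: "(\<Sum>(x, K)\<in>?q. \<bar>f (Sup K) - f (Inf K)\<bar>) \<le> e"
      by linarith
    have "\<bar>f (Sup K) - f (Inf K)\<bar> \<le> e * (Sup K - Inf K)" if xK_p: "(x, K) \<in> p - ?q" for x K
    proof -
      have xK: "x \<notin> N" "x \<in> K" "K \<subseteq> g x"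
        using that p'(2) p(2) by (auto simp: fine_def)
      then have "K \<subseteq> ball x (r x)"
        by (simp add: g_def)
      obtain u v where K: "K = {u..v}"
        using p'(4)[of x K] xK_p by auto
      then have uv: "u \<le> x" "x \<le> v"
        using xK(2) by auto
      then have "u \<in> K" "v \<in> K"
        using K by auto
      then have "u \<in> ball x (r x)" "v \<in> ball x (r x)"
        using \<open>K \<subseteq> ball x (r x)\<close> by blast+
      then have "\<bar>f u - f x\<bar> \<le> e * \<bar>u - x\<bar>" "\<bar>f v - f x\<bar> \<le> e * \<bar>v - x\<bar>"
        using r(2)[OF xK(1)] by (auto simp: dist_real_def abs_minus_commute)
      then show ?thesis
        using uv by (simp add: K algebra_simps)
    qed
    then have "(\<Sum>(x, K)\<in>p - ?q. \<bar>f (Sup K) - f (Inf K)\<bar>) \<le> (\<Sum>(x, K)\<in>p - ?q. e * (Sup K - Inf K))"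
      by (intro sum_mono) auto
    also have "\<dots> \<le> (\<Sum>(x, K)\<in>p. e * (Sup K - Inf K))"
    proof (intro sum_mono2 p'(1))
      fix xK assume "xK \<in> p - (p - ?q)"
      then obtain x K where xK: "xK = (x, K)" "(x, K) \<in> p" by auto
      obtain u v where "K = {u..v}" "x \<in> K"
        using p'(2,4) xK(2) by (metis box_real(2))
      then show "0 \<le> (case xK of (x, K) \<Rightarrow> e * (Sup K - Inf K))"
        using \<open>e > 0\<close> by (simp add: xK(1))
    qed auto
    also have "\<dots> = e * (\<Sum>(x, K)\<in>p. Sup K - Inf K)"
      by (simp add: sum_distrib_left case_prod_unfold)
    also have "\<dots> = e * (b - a)"
      using additive_tagged_division_1[OF \<open>a \<le> b\<close> p(1), of "\<lambda>x. x"] by simp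
    finally have off_N: "(\<Sum>(x, K)\<in>p - ?q. \<bar>f (Sup K) - f (Inf K)\<bar>) \<le> e * (b - a)" .
    have "\<bar>f b - f a\<bar> = \<bar>\<Sum>(x, K)\<in>p. f (Sup K) - f (Inf K)\<bar>"
      by (simp add: additive_tagged_division_1[OF \<open>a \<le> b\<close> p(1)])
    also have "\<dots> \<le> (\<Sum>(x, K)\<in>p. \<bar>f (Sup K) - f (Inf K)\<bar>)"
      by (rule order_trans[OF sum_abs]) (simp add: case_prod_unfold)
    also have "\<dots> = (\<Sum>(x, K)\<in>p - ?q. \<bar>f (Sup K) - f (Inf K)\<bar>) + (\<Sum>(x, K)\<in>?q. \<bar>f (Sup K) - f (Inf K)\<bar>)"
      by (rule sum.subset_diff[OF _ p'(1)]) auto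
    finally show ?thesis
      using on_N off_N by (simp add: algebra_simps)
  qed
  have "\<bar>f b - f a\<bar> \<le> 0 + e" if "e > 0" for e
    using bound[of "e / (1 + (b - a))"] that \<open>a \<le> b\<close> by simp
  then have "\<bar>f b - f a\<bar> \<le> 0"
    by (rule field_le_epsilon)
  then show ?thesis
    by simp
qed

section \<open>Locally integrable functions\<close>

text \<open>Compact intervals suffice as test sets, which turns the closure properties below into
  facts about absolute integrability on an interval.\<close>
lemma L1_loc_iff: "h \<in> L1_loc \<longleftrightarrow> (\<forall>x y. h absolutely_integrable_on {x..y})"
proof
  assume "h \<in> L1_loc"
  then show "\<forall>x y. h absolutely_integrable_on {x..y}"
    by (auto simp: L1_loc_def)
next
  assume h: "\<forall>x y. h absolutely_integrable_on {x..y}"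
  have "h absolutely_integrable_on K" if K: "compact K" for K
  proof -
    obtain x y where "K \<subseteq> {x..y}"
      using compact_imp_bounded[OF K] bounded_subset_cbox_symmetric[of K] by (metis box_real(2))
    moreover have "K \<in> sets lebesgue"
      using K lmeasurable_compact by blast
    ultimately show ?thesis
      using h set_integrable_subset[of lebesgue "{x..y}" h K] by blast
  qed
  then show "h \<in> L1_loc"
    by (auto simp: L1_loc_def)
qed

lemma L1_loc_continuous:
  assumes "continuous_on UNIV g"
  shows "g \<in> L1_loc"
  using assms by (auto simp: L1_loc_iff intro: absolutely_integrable_continuous_real continuous_on_subset)

lemma L1_loc_continuous_mult:
  assumes g: "continuous_on UNIV g" and h: "h \<in> L1_loc"
  shows "(\<lambda>t. g t * h t) \<in> L1_loc"
  unfolding L1_loc_iff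
proof (intro allI)
  fix x y :: real
  have g': "continuous_on {x..y} g"
    using g by (rule continuous_on_subset) simp
  show "(\<lambda>t. g t * h t) absolutely_integrable_on {x..y}"
  proof (rule absolutely_integrable_bounded_measurable_product_real)
    show "g \<in> borel_measurable (lebesgue_on {x..y})"
      using g' by (simp add: continuous_imp_measurable_on_sets_lebesgue)
    show "bounded (g ` {x..y})"
      using g' by (simp add: compact_continuous_image compact_imp_bounded)
    show "h absolutely_integrable_on {x..y}"
      using h by (simp add: L1_loc_iff)
  qed simp
qed

lemma L1_loc_diff: "f \<in> L1_loc \<Longrightarrow> g \<in> L1_loc \<Longrightarrow> (\<lambda>t. f t - g t) \<in> L1_loc"
  by (simp add: L1_loc_iff set_integral_diff)

lemma L1_loc_reflect:
  assumes "h \<in> L1_loc"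
  shows "(\<lambda>t. h (- t)) \<in> L1_loc"
  unfolding L1_loc_iff
proof (intro allI)
  fix x y :: real
  show "(\<lambda>t. h (- t)) absolutely_integrable_on {x..y}"
    using absolutely_integrable_reflect_real[where f = h and a = "- y" and b = "- x"] assms by (simp add: L1_loc_iff)
qed

section \<open>Primitives of locally integrable functions\<close>

text \<open>The primitive is specified by its increments and not by a base point, so that the class is
  stable under the reflection \<open>t \<mapsto> - t\<close> and no oriented integral is needed.\<close>
definition is_primitive :: "(real \<Rightarrow> real) \<Rightarrow> (real \<Rightarrow> real) \<Rightarrow> bool" where
  "is_primitive k F \<longleftrightarrow> (\<forall>x y. x \<le> y \<longrightarrow> (k has_integral F y - F x) {x..y})"

lemma is_primitive_integral:
  "is_primitive k F \<Longrightarrow> x \<le> y \<Longrightarrow> integral {x..y} k = F y - F x"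
  by (simp add: is_primitive_def integral_unique)

lemma is_primitive_exists:
  assumes "k \<in> L1_loc"
  obtains F where "is_primitive k F"
proof
  have int: "k integrable_on {x..y}" for x y
    using assms by (auto simp: L1_loc_iff dest: set_lebesgue_integral_eq_integral)
  define F where "F t = integral {0..t} k - integral {t..0} k" for t
  have "F y - F x = integral {x..y} k" if "x \<le> y" for x y
  proof -
    consider "0 \<le> x" | "x < 0" "0 \<le> y" | "y < 0"
      by linarith
    then show ?thesis
    proof cases
      case 1
      then show ?thesis
        using Henstock_Kurzweil_Integration.integral_combine[where f = k and a = 0 and c = x and b = y] int that by (cases "x = 0"; cases "y = 0") (auto simp: F_def)
    next
      case 2
      then show ?thesis
        using Henstock_Kurzweil_Integration.integral_combine[where f = k and a = x and c = 0 and b = y] int that by (cases "y = 0") (auto simp: F_def)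
    next
      case 3
      then show ?thesis
        using Henstock_Kurzweil_Integration.integral_combine[where f = k and a = x and c = y and b = 0] int that by (auto simp: F_def)
    qed
  qed
  then show "is_primitive k F"
    using int by (auto simp: is_primitive_def)
qed

lemma is_primitive_reflect:
  assumes "is_primitive k F"
  shows "is_primitive (\<lambda>t. - k (- t)) (\<lambda>t. F (- t))"
  unfolding is_primitive_def
proof (intro allI impI)
  fix x y :: real assume "x \<le> y"
  then have "(k has_integral F (- x) - F (- y)) {- y..- x}"
    using assms by (auto simp: is_primitive_def)
  then have "((\<lambda>t. k (- t)) has_integral F (- x) - F (- y)) {x..y}"
    using has_integral_reflect_real[of k _ "- x" "- y"] by simp
  then show "((\<lambda>t. - k (- t)) has_integral F (- y) - F (- x)) {x..y}"
    using has_integral_neg[of "\<lambda>t. k (- t)" "F (- x) - F (- y)"] by simp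
qed

lemma is_primitive_deriv:
  assumes "\<And>t. (F has_real_derivative k t) (at t)"
  shows "is_primitive k F"
  unfolding is_primitive_def
  using assms
  by (simp add: fundamental_theorem_of_calculus has_real_derivative_iff_has_vector_derivative
      has_vector_derivative_at_within)

lemma is_primitive_continuous_deriv:
  assumes F: "is_primitive k F" and k: "continuous_on UNIV k"
  shows "(F has_real_derivative k t) (at t)"
proof -
  have "((\<lambda>u. integral {t - 1..u} k) has_real_derivative k t) (at t within {t - 1..t + 1})"
    by (rule integral_has_real_derivative) (auto intro: continuous_on_subset[OF k])
  then have "((\<lambda>u. F (t - 1) + integral {t - 1..u} k) has_real_derivative k t) (at t within {t - 1..t + 1})"
    by (auto intro!: derivative_eq_intros)
  then have "((\<lambda>u. F (t - 1) + integral {t - 1..u} k) has_real_derivative k t) (at t)"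
    by (simp add: at_within_Icc_at)
  then show ?thesis
  proof (rule DERIV_cong_ev[THEN iffD1, rotated 3])
    show "\<forall>\<^sub>F u in nhds t. F (t - 1) + integral {t - 1..u} k = F u"
    proof (rule eventually_nhds_in_open[of "{t-1<..}" t, THEN eventually_mono])
      fix u assume "u \<in> {t - 1<..}"
      then show "F (t - 1) + integral {t - 1..u} k = F u"
        using is_primitive_integral[OF F, of "t - 1" u] by simp
    qed auto
  qed auto
qed

text \<open>Truncate: \<open>\<bar>k\<bar>\<close> is the sum of a part bounded by \<open>n\<close> and a remainder \<open>r n\<close> whose
  integral tends to \<open>0\<close> by dominated convergence. The increments of \<open>F\<close> over a division are then
  bounded by the small integral of \<open>r n\<close> plus \<open>n\<close> times the total length; using \<open>n + 1\<close> in place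
  of \<open>n\<close> avoids a division by zero.\<close>
lemma is_primitive_W11_loc:
  assumes F: "is_primitive k F" and k: "k \<in> L1_loc"
  shows "F \<in> W11_loc"
  unfolding W11_loc_def abs_continuous_on_def
proof (intro CollectI allI impI)
  fix x y e :: real
  assume "e > 0"
  let ?S = "{x..y}"
  have k_abs: "k absolutely_integrable_on ?S"
    using k by (simp add: L1_loc_iff)
  then have k_int: "k integrable_on ?S" "(\<lambda>t. \<bar>k t\<bar>) integrable_on ?S"
    by (auto simp: absolutely_integrable_on_def)
  have trunc_abs: "(\<lambda>t. min \<bar>k t\<bar> (real n)) absolutely_integrable_on ?S" for n
    using absolutely_integrable_min_1[OF absolutely_integrable_norm[OF k_abs],
        of "\<lambda>_. real n"] by (simp add: absolutely_integrable_on_const)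
  then have trunc_int: "(\<lambda>t. min \<bar>k t\<bar> (real n)) integrable_on ?S" for n
    by (auto simp: absolutely_integrable_on_def)
  define r where "r n t = \<bar>k t\<bar> - min \<bar>k t\<bar> (real n)" for n t
  have r_int: "r n integrable_on ?S" for n
    unfolding r_def using k_int(2) trunc_int by (rule integrable_diff)
  have "(\<lambda>n. integral ?S (r n)) \<longlonglongrightarrow> integral ?S (\<lambda>_. 0)"
  proof (rule dominated_convergence(2)[OF r_int k_int(2)])
    fix t
    show "(\<lambda>n. r n t) \<longlonglongrightarrow> 0"
    proof (rule tendsto_eventually)
      show "\<forall>\<^sub>F n in sequentially. r n t = 0"
        using eventually_ge_at_top[of "nat \<lceil>\<bar>k t\<bar>\<rceil>"]
        by eventually_elim (simp add: r_def nat_ceiling_le_eq)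
    qed
  qed (auto simp: r_def)
  then have "\<forall>\<^sub>F n in sequentially. integral ?S (r n) < e / 2"
    using \<open>e > 0\<close> by (intro order_tendstoD(2)[where y = "integral ?S (\<lambda>_. 0)"]) auto
  then obtain n where n: "integral ?S (r n) < e / 2"
    by (auto simp: eventually_sequentially)
  have "(\<Sum>K\<in>D. \<bar>F (Sup K) - F (Inf K)\<bar>) < e"
    if D: "D division_of T" "T \<subseteq> ?S" "(\<Sum>K\<in>D. Sup K - Inf K) < e / (2 * (real n + 1))" for D T
  proof -
    have "\<bar>F (Sup K) - F (Inf K)\<bar> \<le> integral K (r n) + (real n + 1) * (Sup K - Inf K)"
      if K_D: "K \<in> D" for K
    proof -
      obtain u v where K: "K = {u..v}" "u \<le> v" "Sup K = v" "Inf K = u" and sub: "K \<subseteq> ?S"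
        using division_of_real_memE[OF D(1) K_D] D(2)
        by (metis atLeastAtMost_iff atLeastatMost_subset_iff subsetD)
      have int: "k integrable_on K" "r n integrable_on K" "(\<lambda>_. real n + 1) integrable_on K"
        using integrable_on_subinterval[OF k_int(1)] integrable_on_subinterval[OF r_int] sub
        unfolding K(1) by auto
      have "\<bar>F (Sup K) - F (Inf K)\<bar> = norm (integral K k)"
        using K is_primitive_integral[OF F] by simp
      also have "\<dots> \<le> integral K (\<lambda>t. r n t + (real n + 1))"
        by (rule integral_norm_bound_integral[OF int(1) integrable_add[OF int(2,3)]])
           (auto simp: r_def)
      also have "\<dots> = integral K (r n) + (real n + 1) * (Sup K - Inf K)"
        unfolding Henstock_Kurzweil_Integration.integral_add[OF int(2,3)] using K by simp
      finally show ?thesis .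
    qed
    then have "(\<Sum>K\<in>D. \<bar>F (Sup K) - F (Inf K)\<bar>)
        \<le> (\<Sum>K\<in>D. integral K (r n) + (real n + 1) * (Sup K - Inf K))"
      by (rule sum_mono)
    also have "\<dots> = (\<Sum>K\<in>D. integral K (r n)) + (real n + 1) * (\<Sum>K\<in>D. Sup K - Inf K)"
      by (simp add: sum.distrib sum_distrib_left)
    also have "(\<Sum>K\<in>D. integral K (r n)) \<le> integral ?S (r n)"
    proof -
      have "(r n has_integral (\<Sum>K\<in>D. integral K (r n))) T"
        by (rule has_integral_combine_division_topdown[OF r_int D(1,2)])
      then show ?thesis
        by (rule has_integral_subset_le[OF D(2) _ integrable_integral[OF r_int]]) (auto simp: r_def)
    qed
    also have "(real n + 1) * (\<Sum>K\<in>D. Sup K - Inf K) < (real n + 1) * (e / (2 * (real n + 1)))"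
      using D(3) by (intro mult_strict_left_mono) auto
    also have "(real n + 1) * (e / (2 * (real n + 1))) = e / 2"
      by (simp add: divide_simps)
    finally show ?thesis
      using n by simp
  qed
  moreover have "e / (2 * (real n + 1)) > 0"
    using \<open>e > 0\<close> by simp
  ultimately show "\<exists>\<delta>>0. \<forall>D T. D division_of T \<and> T \<subseteq> ?S \<and> (\<Sum>K\<in>D. Sup K - Inf K) < \<delta> \<longrightarrow>
      (\<Sum>K\<in>D. \<bar>F (Sup K) - F (Inf K)\<bar>) < e"
    by blast
qed

text \<open>Lebesgue's differentiation theorem on the line. Let \<open>bad e x\<close> say that arbitrarily short
  intervals \<open>I\<close> with endpoint \<open>x\<close> violate \<open>\<bar>\<integral>\<^sub>I k - k x * \<bar>I\<bar>\<bar> \<le> e * \<bar>I\<bar>\<close>. By Henstock's lemma, disjoint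
  such intervals that are fine for a suitable gauge have an arbitrarily small total length, and by
  Vitali's covering lemma the five-fold enlargements of countably many disjoint ones cover all bad points.
  The bad points for a given \<open>e\<close> are therefore negligible, and it suffices to let \<open>e\<close> run through
  a sequence tending to \<open>0\<close>.\<close>
lemma is_primitive_AE_deriv:
  assumes F: "is_primitive k F"
  shows "AE t in lebesgue. (F has_real_derivative k t) (at t)"
proof -
  define bad where "bad e x \<longleftrightarrow>
    (\<forall>d>0. \<exists>y. y \<noteq> x \<and> \<bar>y - x\<bar> < d \<and> \<bar>F y - F x - k x * (y - x)\<bar> > e * \<bar>y - x\<bar>)" for e x
  have neg: "negligible {x \<in> {-real m<..<real m}. bad e x}" if "e > 0" for e and m :: nat
    unfolding negligible_outer_le
  proof (intro allI impI)
    fix \<eta> :: real assume "\<eta> > 0"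
    define E where "E = {x \<in> {-real m<..<real m}. bad e x}"
    let ?S = "{-real m..real m}"
    have "(k has_integral F (real m) - F (- real m)) ?S"
      using F by (simp add: is_primitive_def)
    then have "k integrable_on cbox (-real m) (real m)"
      unfolding box_real by (rule has_integral_integrable)
    \<comment> \<open>The covering lemma loses a factor \<open>5\<close>, the lower bound on the deviation a factor \<open>e\<close>.\<close>
    moreover have "e * \<eta> / 5 > 0"
      using \<open>e > 0\<close> \<open>\<eta> > 0\<close> by simp
    ultimately obtain \<gamma> where \<gamma>: "gauge \<gamma>"
      "\<And>p. p tagged_partial_division_of ?S \<Longrightarrow> \<gamma> fine p \<Longrightarrow>
        (\<Sum>(x, K)\<in>p. norm (measure lborel K *\<^sub>R k x - integral K k)) < e * \<eta> / 5"
      by (rule Henstock_lemma) auto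
    have "\<exists>y. y \<noteq> x \<and> closed_segment x y \<subseteq> \<gamma> x \<inter> ?S \<and> \<bar>y - x\<bar> \<le> 2 \<and>
        \<bar>F y - F x - k x * (y - x)\<bar> > e * \<bar>y - x\<bar>" if x_E: "x \<in> E" for x
    proof -
      have "open (\<gamma> x \<inter> {-real m<..<real m})" "x \<in> \<gamma> x \<inter> {-real m<..<real m}"
        using \<gamma>(1) that by (auto simp: gauge_def E_def)
      then obtain d where d: "d > 0" "ball x d \<subseteq> \<gamma> x \<inter> {-real m<..<real m}"
        by (meson open_contains_ball)
      obtain y where y: "y \<noteq> x" "\<bar>y - x\<bar> < min d 2" "\<bar>F y - F x - k x * (y - x)\<bar> > e * \<bar>y - x\<bar>"
        using x_E d(1) unfolding E_def bad_def by (auto dest!: spec[of _ "min d 2"])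
      have "closed_segment x y \<subseteq> ball x d"
        using y(2) d(1) by (intro closed_segment_subset) (auto simp: dist_real_def)
      then show ?thesis
        using y d(2) by fastforce
    qed
    then obtain Y where Y: "\<And>x. x \<in> E \<Longrightarrow> Y x \<noteq> x" "\<And>x. x \<in> E \<Longrightarrow> closed_segment x (Y x) \<subseteq> \<gamma> x \<inter> ?S"
      "\<And>x. x \<in> E \<Longrightarrow> \<bar>Y x - x\<bar> \<le> 2"
      "\<And>x. x \<in> E \<Longrightarrow> \<bar>F (Y x) - F x - k x * (Y x - x)\<bar> > e * \<bar>Y x - x\<bar>"
      by metis
    \<comment> \<open>The intervals are balls about their midpoints, the form that the covering lemma requires.\<close>
    define c where "c x = (x + Y x) / 2" for x
    define \<rho> where "\<rho> x = \<bar>Y x - x\<bar> / 2" for x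
    have seg: "closed_segment x (Y x) = cball (c x) (\<rho> x)" for x
      by (auto simp: closed_segment_eq_real_ivl cball_eq_atLeastAtMost c_def \<rho>_def field_simps abs_if)
    have "E \<subseteq> (\<Union>x\<in>E. cball (c x) (\<rho> x))"
      using seg ends_in_segment(1) by blast
    moreover have "0 < \<rho> x \<and> \<rho> x \<le> 1" if "x \<in> E" for x
      using Y(1,3)[OF that] by (auto simp: \<rho>_def)
    ultimately obtain C where C: "countable C" "C \<subseteq> E"
      "pairwise (\<lambda>i j. disjnt (cball (c i) (\<rho> i)) (cball (c j) (\<rho> j))) C"
      "E \<subseteq> (\<Union>i\<in>C. cball (c i) (5 * \<rho> i))"
      by (rule Vitali_covering_lemma_cballs)
    have bound: "measure lebesgue (\<Union>x\<in>C'. cball (c x) (5 * \<rho> x)) \<le> \<eta>"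
      if C': "C' \<subseteq> C" "finite C'" for C'
    proof -
      let ?p = "(\<lambda>x. (x, closed_segment x (Y x))) ` C'"
      have "?p tagged_partial_division_of ?S"
        unfolding tagged_partial_division_of_def
      proof (intro conjI allI impI)
        show "finite ?p"
          using C'(2) by simp
      next
        fix x K assume "(x, K) \<in> ?p"
        then have x: "x \<in> E" "K = closed_segment x (Y x)"
          using C' C(2) by auto
        then show "x \<in> K" "K \<subseteq> ?S"
          using Y(2) by auto
        show "\<exists>a b. K = cbox a b"
          unfolding x(2) seg by (metis box_real(2) cball_eq_atLeastAtMost)
      next
        fix x1 K1 x2 K2 assume "(x1, K1) \<in> ?p \<and> (x2, K2) \<in> ?p \<and> (x1, K1) \<noteq> (x2, K2)"
        then have "x1 \<in> C" "x2 \<in> C" "x1 \<noteq> x2" "K1 = cball (c x1) (\<rho> x1)" "K2 = cball (c x2) (\<rho> x2)"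
          using C'(1) by (auto simp: seg)
        then have "disjnt K1 K2"
          using C(3) by (simp add: pairwise_def)
        then show "interior K1 \<inter> interior K2 = {}"
          using interior_subset unfolding disjnt_def by blast
      qed
      moreover have "\<gamma> fine ?p"
        using Y(2) C' C(2) by (fastforce simp: fine_def)
      ultimately have "(\<Sum>(x, K)\<in>?p. norm (measure lborel K *\<^sub>R k x - integral K k)) < e * \<eta> / 5"
        by (rule \<gamma>(2))
      then have henstock: "(\<Sum>x\<in>C'. \<bar>measure lborel (closed_segment x (Y x)) * k x - integral (closed_segment x (Y x)) k\<bar>)
          < e * \<eta> / 5"
        by (subst (asm) sum.reindex) (auto simp: inj_on_def)
      have "e * \<bar>Y x - x\<bar> \<le> \<bar>measure lborel (closed_segment x (Y x)) * k x - integral (closed_segment x (Y x)) k\<bar>"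
        if "x \<in> C'" for x
      proof -
        have "x \<in> E"
          using that C' C(2) by blast
        have "\<bar>measure lborel (closed_segment x (Y x)) * k x - integral (closed_segment x (Y x)) k\<bar>
            = \<bar>F (Y x) - F x - k x * (Y x - x)\<bar>"
          by (auto simp: closed_segment_eq_real_ivl is_primitive_integral[OF F] algebra_simps)
        then show ?thesis
          using Y(4)[OF \<open>x \<in> E\<close>] by simp
      qed
      then have "e * (\<Sum>x\<in>C'. \<bar>Y x - x\<bar>) < e * (\<eta> / 5)"
        unfolding sum_distrib_left times_divide_eq_right
        by (rule order.strict_trans1[OF sum_mono henstock])
      then have total: "(\<Sum>x\<in>C'. \<bar>Y x - x\<bar>) < \<eta> / 5"
        using \<open>e > 0\<close> by (rule mult_less_cancel_left_pos[THEN iffD1, rotated])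
      have "measure lebesgue (\<Union>x\<in>C'. cball (c x) (5 * \<rho> x))
          \<le> (\<Sum>x\<in>C'. measure lebesgue (cball (c x) (5 * \<rho> x)))"
        using C'(2) by (intro measure_UNION_le) auto
      also have "\<dots> = 5 * (\<Sum>x\<in>C'. \<bar>Y x - x\<bar>)"
        by (simp add: cball_eq_atLeastAtMost \<rho>_def sum_distrib_left)
      finally show ?thesis
        using total by linarith
    qed
    have "(\<Union>i\<in>C. cball (c i) (5 * \<rho> i)) \<in> lmeasurable"
      by (rule fmeasurable_UN_bound[OF C(1) _ bound]) simp_all
    moreover have "measure lebesgue (\<Union>i\<in>C. cball (c i) (5 * \<rho> i)) \<le> \<eta>"
      by (rule measure_UN_bound[OF C(1) _ bound]) simp_all
    ultimately show "\<exists>T. {x \<in> {-real m<..<real m}. bad e x} \<subseteq> T \<and> T \<in> lmeasurable \<and> measure lebesgue T \<le> \<eta>"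
      using C(4) unfolding E_def by (intro exI conjI)
  qed
  let ?N = "\<Union>(m, n)\<in>(UNIV :: (nat \<times> nat) set). {x \<in> {-real m<..<real m}. bad (1 / (real n + 1)) x}"
  have "negligible ?N"
  proof (rule negligible_countable_Union)
    fix A assume "A \<in> (\<lambda>(m, n). {x \<in> {-real m<..<real m}. bad (1 / (real n + 1)) x}) ` (UNIV :: (nat \<times> nat) set)"
    then obtain m n :: nat where A: "A = {x \<in> {-real m<..<real m}. bad (1 / (real n + 1)) x}"
      by auto
    show "negligible A"
      unfolding A by (rule neg) simp
  qed simp
  moreover have "(F has_real_derivative k x) (at x)" if "x \<notin> ?N" for x
  proof -
    obtain m :: nat where "\<bar>x\<bar> < real m"
      using reals_Archimedean2 by blast
    then have "x \<in> {- real m<..<real m}"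
      by (simp add: abs_less_iff)
    then have good: "\<not> bad (1 / (real n + 1)) x" for n
      using that by blast
    show ?thesis
      unfolding has_field_derivative_def has_derivative_at_alt
    proof (intro conjI allI impI)
      fix e :: real assume "e > 0"
      then obtain n :: nat where n: "1 / (real n + 1) < e"
        using nat_approx_posE by (metis add.commute of_nat_Suc)
      obtain d where "d > 0" and d: "\<And>y. y \<noteq> x \<Longrightarrow> \<bar>y - x\<bar> < d \<Longrightarrow>
          \<bar>F y - F x - k x * (y - x)\<bar> \<le> 1 / (real n + 1) * \<bar>y - x\<bar>"
        using good[of n] unfolding bad_def by (metis not_less)
      have "norm (F y - F x - k x * (y - x)) \<le> e * norm (y - x)" if "norm (y - x) < d" for y
      proof (cases "y = x")
        case False
        then have "\<bar>F y - F x - k x * (y - x)\<bar> \<le> 1 / (real n + 1) * \<bar>y - x\<bar>"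
          using d that by simp
        also have "\<dots> \<le> e * \<bar>y - x\<bar>"
          using n by (intro mult_right_mono) auto
        finally show ?thesis by simp
      qed auto
      then show "\<exists>d>0. \<forall>y. norm (y - x) < d \<longrightarrow> norm (F y - F x - k x * (y - x)) \<le> e * norm (y - x)"
        using \<open>d > 0\<close> by blast
    qed (rule bounded_linear_mult_right)
  qed
  ultimately show ?thesis
    unfolding eventually_ae_filter negligible_iff_null_sets by blast
qed

section \<open>Recovering a locally absolutely continuous function from its derivative\<close>

lemma W11_loc_C1:
  assumes "\<And>t. (f has_real_derivative f' t) (at t)" "continuous_on UNIV f'"
  shows "f \<in> W11_loc"
  by (rule is_primitive_W11_loc[OF is_primitive_deriv L1_loc_continuous]) (fact assms)+

lemma W11_loc_AE_deriv_0_const: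
  assumes f: "f \<in> W11_loc" and deriv: "AE t in lebesgue. (f has_real_derivative 0) (at t)"
  shows "f x = f y"
proof -
  obtain N where N: "N \<in> null_sets lebesgue" "{t. \<not> (f has_real_derivative 0) (at t)} \<subseteq> N"
    using deriv by (auto simp: eventually_ae_filter)
  then have "negligible N" "\<And>t. t \<notin> N \<Longrightarrow> (f has_real_derivative 0) (at t)"
    by (auto simp: negligible_iff_null_sets)
  then have "f x = f y" if "x \<le> y" for x y
    using abs_continuous_on_AE_deriv_0_imp_eq[OF that] f by (simp add: W11_loc_def)
  then show ?thesis
    by (metis linear)
qed

text \<open>A bootstrap from almost everywhere to everywhere: \<open>f\<close> differs by a constant from a
  primitive of \<open>g\<close>, and the latter is differentiable at every point because \<open>g\<close> is continuous.\<close>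
lemma W11_loc_continuous_AE_deriv:
  assumes f: "f \<in> W11_loc" and g: "continuous_on UNIV g"
    and deriv: "AE t in lebesgue. (f has_real_derivative g t) (at t)"
  shows "(f has_real_derivative g t) (at t)"
proof -
  have g_L1: "g \<in> L1_loc"
    using g by (rule L1_loc_continuous)
  then obtain G where G: "is_primitive g G"
    by (rule is_primitive_exists)
  have "(\<lambda>t. f t - G t) \<in> W11_loc"
    by (rule W11_loc_diff[OF f is_primitive_W11_loc[OF G g_L1]])
  moreover have "AE t in lebesgue. ((\<lambda>t. f t - G t) has_real_derivative 0) (at t)"
    using deriv is_primitive_AE_deriv[OF G]
    by eventually_elim (auto intro: derivative_eq_intros)
  ultimately have const: "f t - G t = f 0 - G 0" for t
    by (rule W11_loc_AE_deriv_0_const)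
  define c where "c = f 0 - G 0"
  have "f = (\<lambda>t. G t + c)"
    using const by (auto simp: fun_eq_iff c_def algebra_simps)
  moreover have "((\<lambda>t. G t + c) has_real_derivative g t) (at t)"
    using is_primitive_continuous_deriv[OF G g, of t] by (auto intro: derivative_eq_intros)
  ultimately show ?thesis
    by simp
qed

section \<open>The homogeneous equation\<close>

lemma satisfies_ode_at_iff_DERIV:
  "satisfies_ode_at a b h u t \<longleftrightarrow> (u has_real_derivative h t - a * u (- t) - b * u t) (at t)"
proof
  assume ode: "satisfies_ode_at a b h u t"
  then have "(u has_real_derivative deriv u t) (at t)"
    unfolding satisfies_ode_at_def by (metis DERIV_imp_deriv real_differentiable_def)
  moreover have "deriv u t = h t - a * u (- t) - b * u t"
    using ode unfolding satisfies_ode_at_def by linarith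
  ultimately show "(u has_real_derivative h t - a * u (- t) - b * u t) (at t)"
    by simp
next
  assume "(u has_real_derivative h t - a * u (- t) - b * u t) (at t)"
  then show "satisfies_ode_at a b h u t"
    unfolding satisfies_ode_at_def by (auto simp: DERIV_imp_deriv real_differentiable_def)
qed

text \<open>The reflected term is evaluated pointwise, so superposition holds at each single \<open>t\<close>, which
  lets it be combined with almost-everywhere statements.\<close>
lemma satisfies_ode_at_add_scaled:
  assumes "satisfies_ode_at a b h u t" "satisfies_ode_at a b k v t"
  shows "satisfies_ode_at a b (\<lambda>t. h t + c * k t) (\<lambda>t. u t + c * v t) t"
proof -
  have "((\<lambda>t. u t + c * v t) has_real_derivative
      (h t - a * u (- t) - b * u t) + c * (k t - a * v (- t) - b * v t)) (at t)"
    using assms unfolding satisfies_ode_at_iff_DERIV by (intro DERIV_add DERIV_cmult)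
  then show ?thesis
    unfolding satisfies_ode_at_iff_DERIV by (simp add: algebra_simps)
qed

text \<open>The even and odd fundamental solutions of \<open>y'' = \<delta> y\<close>: hyperbolic, affine or trigonometric
  functions according to the sign of \<open>\<delta>\<close>. Only here does the sign of
  \<open>b\<^sup>2 - a\<^sup>2\<close> matter.\<close>
lemma cosine_sine_pair:
  fixes \<delta> :: real
  obtains C S where
    "\<And>t. (C has_real_derivative \<delta> * S t) (at t)" "\<And>t. (S has_real_derivative C t) (at t)"
    "\<And>t. C (- t) = C t" "\<And>t. S (- t) = - S t"
    "C 0 = 1" "S 0 = 0" "\<And>t. (C t)\<^sup>2 - \<delta> * (S t)\<^sup>2 = 1"
proof -
  define \<omega> where "\<omega> = sqrt \<bar>\<delta>\<bar>"
  consider "\<delta> > 0" | "\<delta> = 0" | "\<delta> < 0"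
    by linarith
  then show thesis
  proof cases
    case 1
    then have w: "\<omega> \<noteq> 0" "\<delta> = \<omega> * \<omega>"
      by (auto simp: \<omega>_def)
    show thesis
      by (rule that[of "\<lambda>t. cosh (\<omega> * t)" "\<lambda>t. sinh (\<omega> * t) / \<omega>"])
         (use w(1) in \<open>auto intro!: derivative_eq_intros simp: w(2) power2_eq_square hyperbolic_pythagoras[unfolded power2_eq_square]\<close>)
  next
    case 2
    show thesis
      by (rule that[of "\<lambda>t. 1" "\<lambda>t. t"]) (auto simp: 2)
  next
    case 3
    then have w: "\<omega> \<noteq> 0" "\<delta> = - (\<omega> * \<omega>)"
      by (auto simp: \<omega>_def)
    show thesis
      by (rule that[of "\<lambda>t. cos (\<omega> * t)" "\<lambda>t. sin (\<omega> * t) / \<omega>"])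
         (use w(1) in \<open>auto intro!: derivative_eq_intros simp: w(2) power2_eq_square sin_cos_squared_add3\<close>)
  qed
qed

text \<open>With \<open>\<delta> = b\<^sup>2 - a\<^sup>2\<close> the function \<open>C - (a + b) S\<close> satisfies the homogeneous
  equation because \<open>C\<close> is even and \<open>S\<close> is odd; hence the defining description of \<open>u_tilde\<close>
  denotes.\<close>
lemma solves_homogeneous_u_tilde: "solves_homogeneous a b (u_tilde a b)"
proof -
  obtain C S :: "real \<Rightarrow> real" where
    C: "\<And>t. (C has_real_derivative (b\<^sup>2 - a\<^sup>2) * S t) (at t)" "\<And>t. C (- t) = C t" "C 0 = 1" and
    S: "\<And>t. (S has_real_derivative C t) (at t)" "\<And>t. S (- t) = - S t" "S 0 = 0"
    using cosine_sine_pair[of "b\<^sup>2 - a\<^sup>2"] by metis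
  have "solves_homogeneous a b (\<lambda>t. C t - (a + b) * S t)"
    unfolding solves_homogeneous_iff_DERIV
    by (auto intro!: derivative_eq_intros C(1) S(1)
        simp: C(2,3) S(2,3) algebra_simps power2_eq_square)
  then show ?thesis
    by (simp add: u_tilde_eqI)
qed

lemma u_tilde_W11_loc: "u_tilde a b \<in> W11_loc"
proof -
  have deriv: "(u_tilde a b has_real_derivative - a * u_tilde a b (- t) - b * u_tilde a b t) (at t)" for t
    using solves_homogeneous_u_tilde by (simp add: solves_homogeneous_iff_DERIV)
  then have cont: "continuous_on A (u_tilde a b)" for A
    by (meson DERIV_isCont continuous_at_imp_continuous_on)
  have "continuous_on UNIV (\<lambda>t. - a * u_tilde a b (- t) - b * u_tilde a b t)"
    by (intro continuous_intros cont continuous_on_compose2[OF cont[of UNIV]]) auto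
  with deriv show ?thesis
    by (rule W11_loc_C1)
qed

text \<open>An absolutely continuous solution \<open>d\<close> is continuous, so the right-hand side
  \<open>- a * d (- t) - b * d t\<close> is continuous too, and the equation holds at every point. Adding
  \<open>(1 - d 0)\<close> times \<open>u_tilde\<close> normalises the value at \<open>0\<close> to \<open>1\<close> without dividing by \<open>d 0\<close>, and
  uniqueness of the classical solution applies.\<close>
lemma homogeneous_solution_eq_multiple_u_tilde:
  assumes d: "d \<in> W11_loc" and ode: "AE t in lebesgue. satisfies_ode_at a b (\<lambda>_. 0) d t"
  shows "d t = d 0 * u_tilde a b t"
proof -
  define w where "w = u_tilde a b"
  have w: "solves_homogeneous a b w"
    unfolding w_def by (rule solves_homogeneous_u_tilde)
  have cont: "continuous_on UNIV d"
    using d by (rule W11_loc_imp_continuous)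
  have d': "(d has_real_derivative - a * d (- t) - b * d t) (at t)" for t
  proof (rule W11_loc_continuous_AE_deriv[OF d])
    show "continuous_on UNIV (\<lambda>t. - a * d (- t) - b * d t)"
      by (intro continuous_intros cont continuous_on_compose2[OF cont]) auto
    show "AE t in lebesgue. (d has_real_derivative - a * d (- t) - b * d t) (at t)"
      using ode by (simp add: satisfies_ode_at_iff_DERIV)
  qed
  have "solves_homogeneous a b (\<lambda>t. d t + (1 - d 0) * w t)"
    using w unfolding solves_homogeneous_iff_DERIV
    by (auto intro!: derivative_eq_intros d' simp: algebra_simps)
  then have "(\<lambda>t. d t + (1 - d 0) * w t) = w"
    using w by (rule solves_homogeneous_unique)
  then have "d t + (1 - d 0) * w t = w t"
    by (rule fun_cong)
  then show ?thesis
    by (simp add: w_def algebra_simps)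
qed

section \<open>Variation of constants\<close>

text \<open>Writing \<open>v t = u (- t)\<close> turns the equation into the linear system
  \<open>(u, v)' = M (u, v) + (h t, - h (- t))\<close> where \<open>M\<close> has the rows \<open>(- b, - a)\<close> and \<open>(a, b)\<close>.
  As \<open>M\<^sup>2 = (b\<^sup>2 - a\<^sup>2) I\<close>, the exponential is \<open>exp (t M) = C t I + S t M\<close>, and the first component
  of \<open>exp (- t M) (h t, - h (- t))\<close> is the function \<open>k\<close> below; its second component is
  \<open>- k (- t)\<close>, with primitive \<open>Y (- t)\<close>. The solution \<open>p\<close> is the first component of \<open>exp (t M) (Y t, Y (- t))\<close>.\<close>
lemma particular_solution_exists:
  assumes h: "h \<in> L1_loc"
  obtains p where "p \<in> W11_loc" "AE t in lebesgue. satisfies_ode_at a b h p t"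
proof -
  define \<delta> where "\<delta> = b\<^sup>2 - a\<^sup>2"
  obtain C S where
    C': "\<And>t. (C has_real_derivative \<delta> * S t) (at t)" and S': "\<And>t. (S has_real_derivative C t) (at t)" and
    parity: "\<And>t. C (- t) = C t" "\<And>t. S (- t) = - S t" and
    "C 0 = 1" "S 0 = 0" and pythagoras: "\<And>t. (C t)\<^sup>2 - \<delta> * (S t)\<^sup>2 = 1"
    by (rule cosine_sine_pair[of \<delta>]) (rule that)
  have "isCont C t" "isCont S t" for t
    by (rule DERIV_isCont[OF C'] DERIV_isCont[OF S'])+
  then have cont: "continuous_on UNIV C" "continuous_on UNIV S"
    by (simp_all add: continuous_at_imp_continuous_on)
  have CS_W11: "C \<in> W11_loc" "S \<in> W11_loc"
    by (rule W11_loc_C1[OF C'] W11_loc_C1[OF S'], intro continuous_intros cont)+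
  define k where "k t = (C t + b * S t) * h t - a * S t * h (- t)" for t
  have "(\<lambda>t. (C t + b * S t) * h t) \<in> L1_loc"
    by (rule L1_loc_continuous_mult[OF _ h]) (intro continuous_intros cont)
  moreover have "(\<lambda>t. a * S t * h (- t)) \<in> L1_loc"
    by (rule L1_loc_continuous_mult[OF _ L1_loc_reflect[OF h]]) (intro continuous_intros cont)
  ultimately have k: "k \<in> L1_loc"
    unfolding k_def by (rule L1_loc_diff)
  then obtain Y where Y: "is_primitive k Y"
    by (rule is_primitive_exists)
  define Z where "Z t = Y (- t)" for t
  have Z: "is_primitive (\<lambda>t. - k (- t)) Z"
    unfolding Z_def by (rule is_primitive_reflect[OF Y])
  have k_reflect: "(\<lambda>t. - k (- t)) \<in> L1_loc"
    using L1_loc_continuous_mult[OF _ L1_loc_reflect[OF k], of "\<lambda>_. - 1"] by simp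
  define p where "p t = (C t - b * S t) * Y t - a * S t * Z t" for t
  have "p \<in> W11_loc"
    unfolding p_def
    by (intro W11_loc_diff W11_loc_mult W11_loc_const CS_W11
        is_primitive_W11_loc[OF Y k] is_primitive_W11_loc[OF Z k_reflect])
  moreover have "AE t in lebesgue. satisfies_ode_at a b h p t"
    using is_primitive_AE_deriv[OF Y] is_primitive_AE_deriv[OF Z]
  proof eventually_elim
    case (elim t)
    have "(p has_real_derivative
        (\<delta> * S t - b * C t) * Y t + (C t - b * S t) * k t - a * C t * Z t + a * S t * k (- t)) (at t)"
      unfolding p_def
      by (auto intro!: derivative_eq_intros C' S' elim simp: algebra_simps)
    moreover have "(\<delta> * S t - b * C t) * Y t + (C t - b * S t) * k t - a * C t * Z t + a * S t * k (- t)
        = h t - a * p (- t) - b * p t"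
    proof -
      have "(C t - b * S t) * k t + a * S t * k (- t) = h t * ((C t)\<^sup>2 - \<delta> * (S t)\<^sup>2)"
        by (simp add: k_def parity \<delta>_def algebra_simps power2_eq_square)
      then have "(C t - b * S t) * k t + a * S t * k (- t) = h t"
        by (simp add: pythagoras)
      moreover have "(\<delta> * S t - b * C t) * Y t - a * C t * Z t + a * p (- t) + b * p t = 0"
        by (simp add: p_def Z_def parity \<delta>_def algebra_simps power2_eq_square)
      ultimately show ?thesis
        by linarith
    qed
    ultimately show ?case
      by (simp add: satisfies_ode_at_iff_DERIV)
  qed
  ultimately show thesis
    by (rule that)
qed

section \<open>Unique solvability of the initial value problem\<close>

theorem corollary2p3:
  fixes a b c t0 :: real and h :: "real \<Rightarrow> real"
  assumes "h \<in> L1_loc"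
  shows "(\<exists>!u. u \<in> W11_loc \<and> (AE t in lebesgue. satisfies_ode_at a b h u t) \<and> u t0 = c)
           \<longleftrightarrow> u_tilde a b t0 \<noteq> 0"
proof -
  define w where "w = u_tilde a b"
  have w: "w \<in> W11_loc" "w 0 = 1" "\<And>t. satisfies_ode_at a b (\<lambda>_. 0) w t"
    using u_tilde_W11_loc[of a b] solves_homogeneous_u_tilde[of a b]
    by (auto simp: w_def solves_homogeneous_def)
  define sol where "sol u \<longleftrightarrow> u \<in> W11_loc \<and> (AE t in lebesgue. satisfies_ode_at a b h u t)" for u
  have shift: "sol (\<lambda>t. u t + r * w t)" if "sol u" for u r
  proof -
    have "satisfies_ode_at a b h (\<lambda>t. u t + r * w t) t" if "satisfies_ode_at a b h u t" for t
      using satisfies_ode_at_add_scaled[OF that w(3), of r] by simp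
    then have "AE t in lebesgue. satisfies_ode_at a b h (\<lambda>t. u t + r * w t) t"
      using that unfolding sol_def by (auto elim: eventually_mono)
    then show ?thesis
      using that w(1) by (simp add: sol_def W11_loc_add W11_loc_mult W11_loc_const)
  qed
  have difference: "u t - v t = (u 0 - v 0) * w t" if "sol u" "sol v" for u v t
  proof -
    have "AE t in lebesgue. satisfies_ode_at a b h u t" "AE t in lebesgue. satisfies_ode_at a b h v t"
      using that by (auto simp: sol_def)
    then have "AE t in lebesgue. satisfies_ode_at a b (\<lambda>_. 0) (\<lambda>t. u t - v t) t"
    proof eventually_elim
      case (elim t)
      then show ?case
        using satisfies_ode_at_add_scaled[OF elim, of "- 1"] by simp
    qed
    moreover have "(\<lambda>t. u t - v t) \<in> W11_loc"
      using that by (simp add: sol_def W11_loc_diff)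
    ultimately show ?thesis
      unfolding w_def by (intro homogeneous_solution_eq_multiple_u_tilde)
  qed
  \<comment> \<open>The solutions form the line \<open>p + r w\<close>, on which evaluation at \<open>t0\<close> is a bijection
    exactly if \<open>w t0 \<noteq> 0\<close>.\<close>
  have "(\<exists>!u. sol u \<and> u t0 = c) \<longleftrightarrow> w t0 \<noteq> 0"
  proof
    assume unique: "\<exists>!u. sol u \<and> u t0 = c"
    then obtain u where u: "sol u" "u t0 = c" and only: "\<And>v. sol v \<and> v t0 = c \<Longrightarrow> v = u"
      by (elim ex1E) blast
    show "w t0 \<noteq> 0"
    proof
      assume "w t0 = 0"
      then have "sol (\<lambda>t. u t + 1 * w t) \<and> u t0 + 1 * w t0 = c"
        using shift[OF u(1), of 1] u(2) by simp
      then have "(\<lambda>t. u t + 1 * w t) = u"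
        by (rule only)
      then have "u 0 + 1 * w 0 = u 0"
        by (rule fun_cong)
      then show False
        using w(2) by simp
    qed
  next
    assume nz: "w t0 \<noteq> 0"
    obtain p where "sol p"
      using particular_solution_exists[OF assms] unfolding sol_def by blast
    show "\<exists>!u. sol u \<and> u t0 = c"
    proof (rule ex_ex1I)
      show "\<exists>u. sol u \<and> u t0 = c"
        using shift[OF \<open>sol p\<close>, of "(c - p t0) / w t0"] nz
        by (intro exI[of _ "\<lambda>t. p t + (c - p t0) / w t0 * w t"]) simp
    next
      fix u v assume uv: "sol u \<and> u t0 = c" "sol v \<and> v t0 = c"
      then have "(u 0 - v 0) * w t0 = 0"
        using difference[of u v t0] by simp
      then have "u 0 - v 0 = 0"
        using nz by simp
      then have "u t - v t = 0" for t
        using difference[of u v t] uv by simp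
      then show "u = v"
        by (auto simp: fun_eq_iff)
    qed
  qed
  then show ?thesis
    by (simp add: sol_def w_def conj_assoc)
qed

end
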